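(* Let $\pi:(X,T)\to(Y,S)$ be a factor map, where $(X,T)$ and $(Y,S)$ are expansive with expansivity constants $\delta$ and $\eta$ respectively. (1) If $(X,T)$ has non-uniform specification with gap bounds $f(n)$ at scale $\delta$ where $\liminf_{n\to\infty}f(n)/\ln n=0$, then there exists $\overline{f}(n)$ with $\liminf_{n\to\infty}\overline{f}(n)/\ln n=0$ for which $(Y,S)$ has non-uniform specification with gap bounds $\overline{f}(n)$ at scale $\eta$. (2) If $(X,T)$ has non-uniform transitivity with gap bounds $f(n)$ at scale $\delta$ where $\lim_{n\to\infty}f(n)/\ln n=0$, then there exists $\overline{f}(n)$ with $\lim_{n\to\infty}\overline{f}(n)/\ln n=0$ for which $(Y,S)$ has non-uniform transitivity with gap bounds $\overline{f}(n)$ at scale $\eta$.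
   Context: A dynamical system $(X,T)$ is a compact metric space $(X,d)$ with a homeomorphism $T:X\to X$. It is expansive with expansivity constant $\delta>0$ if for all $x\ne y$ in $X$ there is $n\in\mathbb{Z}$ with $d(T^nx,T^ny)>\delta$. A factor map $\pi:(X,T)\to(Y,S)$ is a continuous surjection with $\pi\circ T=S\circ\pi$. Shadowing: $z\in X$ $\eta$-shadows $(x_1,\dots,x_k)$ for $(n_1,\dots,n_k)$ iterates with gaps $(m_1,\dots,m_{k-1})$ if $d(T^{m+\sum_{j=1}^{i-1}(n_j+m_j)}z,T^mx_i)<\eta$ for every $1\le i\le k$ and $0\le m<n_i$. Let $f:\mathbb{N}\to\mathbb{N}$ be increasing (i.e. nondecreasing; values may be $0$). $(X,T)$ has non-uniform specification with gap bounds $f(n)$ at scale $\eta$ if for any $k\ge 1$, any $x_1,\dots,x_k\in X$, any positive integers $n_1,\dots,n_k$ and any integers $m_1,\dots,m_{k-1}$ with $m_i\ge\max(f(n_i),f(n_{i+1}))$, there is $z\in X$ which $\eta$-shadows $(x_i)$ for $(n_i)$ iterates with gaps $(m_i)$. $(X,T)$ has non-uniform transitivity with gap bounds $f(n)$ at scale $\eta$ if for any $n\ge1$ and any $x,y\in X$, there exist an integer $0\le i\le f(n)$ and $z\in X$ which $\eta$-shadows $(x,y)$ for $(n,n)$ iterates with gap $i$. *)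

theory Defs
  imports "HOL-Analysis.Analysis"
begin

text \<open>
  Systems live on a carrier set \<open>X\<close> inside a metric space type; the map \<open>T\<close> is only relevant
  on \<open>X\<close>.
\<close>

definition dynamical_system :: "'a::metric_space set \<Rightarrow> ('a \<Rightarrow> 'a) \<Rightarrow> bool" where
  "dynamical_system X T \<longleftrightarrow> compact X \<and> (\<exists>T'. homeomorphism X X T T')"

definition int_iterate :: "'a set \<Rightarrow> ('a \<Rightarrow> 'a) \<Rightarrow> int \<Rightarrow> 'a \<Rightarrow> 'a" where
  "int_iterate X T n =
     (if n \<ge> 0 then T ^^ nat n else inv_into X T ^^ nat (- n))"

definition expansive :: "'a::metric_space set \<Rightarrow> ('a \<Rightarrow> 'a) \<Rightarrow> real \<Rightarrow> bool" where
  "expansive X T \<delta> \<longleftrightarrow> \<delta> > 0 \<and>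
     (\<forall>x\<in>X. \<forall>y\<in>X. x \<noteq> y \<longrightarrow>
        (\<exists>n::int. dist (int_iterate X T n x) (int_iterate X T n y) > \<delta>))"

definition factor_map ::
  "'a::metric_space set \<Rightarrow> ('a \<Rightarrow> 'a) \<Rightarrow> 'b::metric_space set \<Rightarrow> ('b \<Rightarrow> 'b) \<Rightarrow> ('a \<Rightarrow> 'b) \<Rightarrow> bool"
where
  "factor_map X T Y S \<pi> \<longleftrightarrow>
     continuous_on X \<pi> \<and> \<pi> ` X = Y \<and> (\<forall>x\<in>X. \<pi> (T x) = S (\<pi> x))"

text \<open>
  The tuples \<open>(x\<^sub>1,\<dots>,x\<^sub>k)\<close>, \<open>(n\<^sub>1,\<dots>,n\<^sub>k)\<close> and \<open>(m\<^sub>1,\<dots>,m\<^sub>k\<^sub>-\<^sub>1)\<close> are lists of lengths \<open>k\<close>, \<open>k\<close> and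
  \<open>k - 1\<close>, so that indices start at \<open>0\<close>.
\<close>

definition shadows ::
  "('a::metric_space \<Rightarrow> 'a) \<Rightarrow> real \<Rightarrow> 'a \<Rightarrow> 'a list \<Rightarrow> nat list \<Rightarrow> nat list \<Rightarrow> bool"
where
  "shadows T \<eta> z xs ns ms \<longleftrightarrow>
     (\<forall>i<length xs. \<forall>m<ns ! i.
        dist ((T ^^ (m + (\<Sum>j<i. ns ! j + ms ! j))) z) ((T ^^ m) (xs ! i)) < \<eta>)"

text \<open>
  Gaps are natural numbers, since gap bounds are nonnegative.
  Monotonicity of the gap bound \<open>f\<close> is not part of the next two definitions.
\<close>

definition nonuniform_specification ::
  "'a::metric_space set \<Rightarrow> ('a \<Rightarrow> 'a) \<Rightarrow> (nat \<Rightarrow> nat) \<Rightarrow> real \<Rightarrow> bool"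
where
  "nonuniform_specification X T f \<eta> \<longleftrightarrow>
     (\<forall>k\<ge>1. \<forall>xs ns ms.
        length xs = k \<and> set xs \<subseteq> X \<and>
        length ns = k \<and> (\<forall>n\<in>set ns. n > 0) \<and>
        length ms = k - 1 \<and> (\<forall>i<k - 1. ms ! i \<ge> max (f (ns ! i)) (f (ns ! Suc i)))
        \<longrightarrow> (\<exists>z\<in>X. shadows T \<eta> z xs ns ms))"

definition nonuniform_transitivity ::
  "'a::metric_space set \<Rightarrow> ('a \<Rightarrow> 'a) \<Rightarrow> (nat \<Rightarrow> nat) \<Rightarrow> real \<Rightarrow> bool"
where
  "nonuniform_transitivity X T f \<eta> \<longleftrightarrow>
     (\<forall>n\<ge>1. \<forall>x\<in>X. \<forall>y\<in>X. \<exists>i\<le>f n. \<exists>z\<in>X. shadows T \<eta> z [x, y] [n, n] [i])"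

end

theory Submission
  imports Defs "HOL-Real_Asymp.Real_Asymp"
begin

text \<open>
  A factor map is uniformly continuous, so it turns \<open>\<epsilon>\<close>-shadowing in \<open>X\<close> into \<open>\<eta>\<close>-shadowing in
  \<open>Y\<close> for some \<open>\<epsilon> > 0\<close>. Only shadowing at the expansivity scale \<open>\<delta>\<close> is given in \<open>X\<close>, but on a
  compact space expansivity is uniform: there is \<open>N\<close> such that two orbits which stay
  \<open>\<delta>\<close>-close during the times \<open>-N, \<dots>, N\<close> are \<open>\<epsilon>\<close>-close at time \<open>0\<close>
  (\<open>uniform_expansivity\<close>). Hence \<open>\<delta>\<close>-shadowing of an orbit segment lengthened by \<open>N\<close> steps at
  both ends gives \<open>\<epsilon>\<close>-shadowing of the segment itself, and the lengthening is paid for by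
  \<open>2N\<close> units of each gap (\<open>shadows_factor\<close>).

  Both properties therefore pass to the factor with gap bound \<open>n \<mapsto> f (n + 2N) + 2N\<close>. As
  \<open>ln (n + 2N) / ln n\<close> tends to \<open>1\<close>, a shift of the argument and an additive constant
  change neither of the two growth conditions relative to \<open>ln n\<close>.
\<close>

section \<open>Iterates of a homeomorphism\<close>

lemma dynamical_system_inverse:
  assumes "dynamical_system X T"
  defines "g \<equiv> inv_into X T"
  shows "compact X" "continuous_on X T" "continuous_on X g"
    and "T ` X = X" "g ` X = X"
    and "\<And>x. x \<in> X \<Longrightarrow> g (T x) = x" "\<And>x. x \<in> X \<Longrightarrow> T (g x) = x"
proof -
  obtain T' where c: "compact X" and h: "homeomorphism X X T T'"
    using assms(1) by (auto simp: dynamical_system_def)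
  have inj: "inj_on T X"
    using h by (metis homeomorphism_apply1 inj_onI)
  have im: "T ` X = X" and im': "T' ` X = X"
    using h by (auto simp: homeomorphism_def)
  have eq: "g x = T' x" if "x \<in> X" for x
  proof -
    have "T' x \<in> X" "T (T' x) = x"
      using that h im' by (auto simp: homeomorphism_def)
    then show ?thesis
      unfolding g_def using inj by (metis inv_into_f_f)
  qed
  show "compact X" "T ` X = X" by (fact c im)+
  show "continuous_on X T"
    using h by (simp add: homeomorphism_def)
  show "continuous_on X g"
    using h eq by (metis continuous_on_cong homeomorphism_def)
  show "g ` X = X"
    using eq im' by force
  show "g (T x) = x" if "x \<in> X" for x
    unfolding g_def using inj that by simp
  show "T (g x) = x" if "x \<in> X" for x
    unfolding g_def using im that by (simp add: f_inv_into_f)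
qed

lemma funpow_in_image:
  assumes "h ` X = X" "x \<in> X"
  shows "(h ^^ n) x \<in> X"
  using assms by (induction n) auto

lemma continuous_on_funpow:
  assumes "continuous_on X h" "h ` X = X"
  shows "continuous_on X (h ^^ n)"
proof (induction n)
  case 0
  then show ?case by (simp add: continuous_on_id)
next
  case (Suc n)
  have "(h ^^ n) ` X \<subseteq> X"
    using funpow_in_image[OF assms(2)] by (intro image_subsetI)
  then have "continuous_on ((h ^^ n) ` X) h"
    using assms(1) continuous_on_subset by blast
  with Suc show ?case
    using continuous_on_compose by fastforce
qed

lemma funpow_inverse_cancel:
  assumes "\<And>x. x \<in> X \<Longrightarrow> g (h x) = x" "h ` X = X" "x \<in> X"
  shows "(g ^^ n) ((h ^^ (n + k)) x) = (h ^^ k) x"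
proof (induction n)
  case (Suc n)
  have "(g ^^ Suc n) ((h ^^ (Suc n + k)) x) = (g ^^ n) (g (h ((h ^^ (n + k)) x)))"
  proof -
    have "(g ^^ Suc n) y = (g ^^ n) (g y)" for y
      by (simp only: funpow_Suc_right comp_apply)
    then show ?thesis by simp
  qed
  with Suc show ?case
    using assms funpow_in_image[OF assms(2,3)] by simp
qed simp

lemma int_iterate_funpow:
  assumes "dynamical_system X T" "x \<in> X" "\<bar>n\<bar> \<le> int N"
  shows "int_iterate X T n ((T ^^ N) x) = (T ^^ nat (int N + n)) x"
proof (cases "n \<ge> 0")
  case True
  then have "nat (int N + n) = nat n + N" by linarith
  then show ?thesis
    using True by (simp add: int_iterate_def funpow_add)
next
  case False
  then have "N = nat (- n) + nat (int N + n)"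
    using assms(3) by linarith
  moreover have "(inv_into X T ^^ nat (- n)) ((T ^^ (nat (- n) + nat (int N + n))) x)
      = (T ^^ nat (int N + n)) x"
    by (rule funpow_inverse_cancel[of X])
       (use dynamical_system_inverse[OF assms(1)] assms(2) in auto)
  ultimately show ?thesis
    using False by (simp add: int_iterate_def)
qed

lemma continuous_on_int_iterate:
  assumes "dynamical_system X T"
  shows "continuous_on X (int_iterate X T n)"
proof -
  note D = dynamical_system_inverse[OF assms]
  show ?thesis
    using continuous_on_funpow[OF D(2,4)] continuous_on_funpow[OF D(3,5)]
    unfolding int_iterate_def by presburger
qed

lemma factor_map_funpow:
  assumes "factor_map X T Y S \<pi>" "T ` X = X" "x \<in> X"
  shows "\<pi> ((T ^^ n) x) = (S ^^ n) (\<pi> x)"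
proof (induction n)
  case (Suc n)
  then show ?case
    using assms(1) funpow_in_image[OF assms(2,3), of n] by (simp add: factor_map_def)
qed simp

section \<open>Uniform expansivity\<close>

text \<open>
  If pairs of points violated the claim for every \<open>N\<close>, a limit of their midpoints
  \<open>T\<^sup>N x\<close>, \<open>T\<^sup>N y\<close> would be two points at distance at least \<open>\<epsilon>\<close> whose full orbits stay
  \<open>\<delta>\<close>-close. The window is \<open>0, \<dots>, 2N\<close> with midpoint \<open>N\<close>, instead of \<open>-N, \<dots>, N\<close>,
  in order to speak of forward iterates only.
\<close>

lemma uniform_expansivity:
  fixes X :: "'a::metric_space set"
  assumes ds: "dynamical_system X T" and ex: "expansive X T \<delta>" and "\<epsilon> > 0"
  obtains N where "\<And>x y. \<lbrakk>x \<in> X; y \<in> X; \<And>m. m \<le> 2 * N \<Longrightarrow> dist ((T ^^ m) x) ((T ^^ m) y) \<le> \<delta>\<rbrakk>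
    \<Longrightarrow> dist ((T ^^ N) x) ((T ^^ N) y) < \<epsilon>"
proof -
  note D = dynamical_system_inverse[OF ds]
  have "\<exists>N. \<forall>x\<in>X. \<forall>y\<in>X. (\<forall>m\<le>2*N. dist ((T ^^ m) x) ((T ^^ m) y) \<le> \<delta>)
      \<longrightarrow> dist ((T ^^ N) x) ((T ^^ N) y) < \<epsilon>"
  proof (rule ccontr)
    assume "\<not> ?thesis"
    then have "\<forall>N. \<exists>x y. x \<in> X \<and> y \<in> X \<and> (\<forall>m\<le>2*N. dist ((T ^^ m) x) ((T ^^ m) y) \<le> \<delta>)
      \<and> \<epsilon> \<le> dist ((T ^^ N) x) ((T ^^ N) y)"
      by (meson not_less)
    then obtain x y where xy: "\<And>N. x N \<in> X" "\<And>N. y N \<in> X"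
      and close: "\<And>N m. m \<le> 2*N \<Longrightarrow> dist ((T ^^ m) (x N)) ((T ^^ m) (y N)) \<le> \<delta>"
      and apart: "\<And>N. \<epsilon> \<le> dist ((T ^^ N) (x N)) ((T ^^ N) (y N))"
      by metis
    define u where "u = (\<lambda>N. (T ^^ N) (x N))"
    define v where "v = (\<lambda>N. (T ^^ N) (y N))"
    have uX: "u N \<in> X" and vX: "v N \<in> X" for N
      unfolding u_def v_def by (intro funpow_in_image[OF D(4)] xy)+
    have "seq_compact (X \<times> X)"
      using D(1) by (intro compact_imp_seq_compact compact_Times)
    then obtain l r where l: "l \<in> X \<times> X" and r: "strict_mono r"
      and lim: "((\<lambda>N. (u N, v N)) \<circ> r) \<longlonglongrightarrow> l"
      by (rule seq_compactE[of _ "\<lambda>N. (u N, v N)"]) (use uX vX in auto)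
    obtain a b where ab: "l = (a, b)" "a \<in> X" "b \<in> X"
      using l by auto
    have limu: "(\<lambda>k. u (r k)) \<longlonglongrightarrow> a" and limv: "(\<lambda>k. v (r k)) \<longlonglongrightarrow> b"
      using tendsto_fst[OF lim] tendsto_snd[OF lim] ab by (auto simp: o_def)
    have "dist a b \<ge> \<epsilon>"
      by (rule tendsto_lowerbound[OF tendsto_dist[OF limu limv]])
         (use apart in \<open>auto simp: u_def v_def\<close>)
    with \<open>\<epsilon> > 0\<close> have "a \<noteq> b" by auto
    with ex ab obtain n where n: "dist (int_iterate X T n a) (int_iterate X T n b) > \<delta>"
      unfolding expansive_def by blast
    have lim_it: "(\<lambda>k. int_iterate X T n (w (r k))) \<longlonglongrightarrow> int_iterate X T n c"
      if "\<And>N. w N \<in> X" "c \<in> X" "(\<lambda>k. w (r k)) \<longlonglongrightarrow> c" for w c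
      using continuous_on_tendsto_compose[OF continuous_on_int_iterate[OF ds] that(3,2)] that(1)
      by auto
    have "dist (int_iterate X T n a) (int_iterate X T n b) \<le> \<delta>"
    proof (rule tendsto_upperbound)
      show "(\<lambda>k. dist (int_iterate X T n (u (r k))) (int_iterate X T n (v (r k))))
          \<longlonglongrightarrow> dist (int_iterate X T n a) (int_iterate X T n b)"
        by (rule tendsto_dist[OF lim_it[OF uX ab(2) limu] lim_it[OF vX ab(3) limv]])
      have "dist (int_iterate X T n (u (r k))) (int_iterate X T n (v (r k))) \<le> \<delta>"
        if "k \<ge> nat \<bar>n\<bar>" for k
      proof -
        have "\<bar>n\<bar> \<le> int (r k)"
          using that seq_suble[OF r, of k] by linarith
        then show ?thesis
          unfolding u_def v_def using close xy
          by (simp add: int_iterate_funpow[OF ds])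
      qed
      then show "\<forall>\<^sub>F k in sequentially.
          dist (int_iterate X T n (u (r k))) (int_iterate X T n (v (r k))) \<le> \<delta>"
        using eventually_sequentially by blast
    qed simp
    with n show False by simp
  qed
  with that show thesis by blast
qed

section \<open>Transport of shadowing to a factor\<close>

text \<open>
  Uniform continuity of \<open>\<pi>\<close> supplies the scale \<open>\<epsilon>\<close> in \<open>X\<close> at which uniform expansivity is
  applied; the resulting \<open>N\<close> carries all the information on \<open>\<delta>\<close> and \<open>\<eta>\<close> that the transport
  of shadowing uses.
\<close>

lemma factor_map_window:
  fixes X :: "'a::metric_space set" and Y :: "'b::metric_space set"
  assumes ds: "dynamical_system X T" and fm: "factor_map X T Y S \<pi>"
    and ex: "expansive X T \<delta>" and "\<eta> > 0"
  obtains N where "\<forall>x\<in>X. \<forall>y\<in>X. (\<forall>m\<le>2 * N. dist ((T ^^ m) x) ((T ^^ m) y) < \<delta>)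
    \<longrightarrow> dist (\<pi> ((T ^^ N) x)) (\<pi> ((T ^^ N) y)) < \<eta>"
proof -
  note D = dynamical_system_inverse[OF ds]
  have "uniformly_continuous_on X \<pi>"
    using fm D(1) by (simp add: factor_map_def compact_uniformly_continuous)
  then obtain \<epsilon> where "\<epsilon> > 0"
    and \<epsilon>: "\<And>x y. \<lbrakk>x \<in> X; y \<in> X; dist x y < \<epsilon>\<rbrakk> \<Longrightarrow> dist (\<pi> x) (\<pi> y) < \<eta>"
    using \<open>\<eta> > 0\<close> unfolding uniformly_continuous_on_def by (metis dist_commute)
  obtain N where N: "\<And>x y. \<lbrakk>x \<in> X; y \<in> X; \<And>m. m \<le> 2 * N \<Longrightarrow> dist ((T ^^ m) x) ((T ^^ m) y) \<le> \<delta>\<rbrakk>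
    \<Longrightarrow> dist ((T ^^ N) x) ((T ^^ N) y) < \<epsilon>"
    using uniform_expansivity[OF ds ex \<open>\<epsilon> > 0\<close>] by blast
  show thesis
  proof (rule that, intro ballI impI)
    fix x y
    assume "x \<in> X" "y \<in> X" and "\<forall>m\<le>2 * N. dist ((T ^^ m) x) ((T ^^ m) y) < \<delta>"
    then show "dist (\<pi> ((T ^^ N) x)) (\<pi> ((T ^^ N) y)) < \<eta>"
      by (intro \<epsilon> N funpow_in_image[OF D(4)]) (auto intro: less_imp_le)
  qed
qed

text \<open>
  The segments in \<open>X\<close> start \<open>N\<close> steps before the given points and last \<open>2N\<close> steps longer, while
  the gaps are \<open>2N\<close> shorter; hence all starting times agree up to the common shift by \<open>N\<close>, which
  is absorbed into the shadowing point.
\<close>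

lemma shadows_factor:
  fixes X :: "'a::metric_space set" and Y :: "'b::metric_space set"
  assumes ds: "dynamical_system X T" and fm: "factor_map X T Y S \<pi>"
    and window: "\<forall>x\<in>X. \<forall>y\<in>X. (\<forall>m\<le>2 * N. dist ((T ^^ m) x) ((T ^^ m) y) < \<delta>)
      \<longrightarrow> dist (\<pi> ((T ^^ N) x)) (\<pi> ((T ^^ N) y)) < \<eta>"
    and xs: "set xs \<subseteq> X" and z: "z \<in> X"
    and len: "length ns = length xs" "length ms = length xs - 1"
    and sh: "shadows T \<delta> z (map (inv_into X T ^^ N) xs) (map (\<lambda>n. n + 2 * N) ns) ms"
  shows "shadows S \<eta> (\<pi> ((T ^^ N) z)) (map \<pi> xs) ns (map (\<lambda>m. m + 2 * N) ms)"
  unfolding shadows_def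
proof (intro allI impI)
  note D = dynamical_system_inverse[OF ds]
  fix i m
  assume "i < length (map \<pi> xs)" and m: "m < ns ! i"
  then have i: "i < length xs" by simp
  define s where "s = (\<Sum>j<i. ns ! j + map (\<lambda>m. m + 2 * N) ms ! j)"
  define w where "w = (inv_into X T ^^ N) (xs ! i)"
  have s: "s = (\<Sum>j<i. map (\<lambda>n. n + 2 * N) ns ! j + ms ! j)"
    unfolding s_def by (rule sum.cong) (use i len in auto)
  have xi: "xs ! i \<in> X" using xs i by auto
  have wX: "w \<in> X"
    unfolding w_def using funpow_in_image[OF D(5) xi] .
  have Tw: "(T ^^ N) w = xs ! i"
    unfolding w_def
    using funpow_inverse_cancel[of X T "inv_into X T" "xs ! i" N 0] D xi by simp
  have close: "dist ((T ^^ (q + s)) z) ((T ^^ q) w) < \<delta>" if "q < ns ! i + 2 * N" for q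
    using sh i that len by (auto simp: shadows_def s w_def)
  have "dist (\<pi> ((T ^^ N) ((T ^^ (m + s)) z))) (\<pi> ((T ^^ N) ((T ^^ m) w))) < \<eta>"
  proof (rule window[rule_format])
    fix q assume "q \<le> 2 * N"
    then have "dist ((T ^^ (q + m + s)) z) ((T ^^ (q + m)) w) < \<delta>"
      using m by (intro close) simp
    then show "dist ((T ^^ q) ((T ^^ (m + s)) z)) ((T ^^ q) ((T ^^ m) w)) < \<delta>"
      by (simp add: funpow_add add.assoc)
  qed (use z wX funpow_in_image[OF D(4)] in auto)
  moreover have "(T ^^ N) ((T ^^ j) x) = (T ^^ j) ((T ^^ N) x)" for j x
    by (metis add.commute comp_apply funpow_add)
  ultimately show "dist ((S ^^ (m + (\<Sum>j<i. ns ! j + map (\<lambda>m. m + 2 * N) ms ! j))) (\<pi> ((T ^^ N) z)))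
      ((S ^^ m) (map \<pi> xs ! i)) < \<eta>"
    using i xi Tw factor_map_funpow[OF fm D(4)] funpow_in_image[OF D(4) z] by (simp flip: s_def)
qed

text \<open>
  Gaps which respect the bound for \<open>Y\<close> are at least \<open>2N\<close>, so shortening them by \<open>2N\<close> in the
  natural numbers loses nothing, and the shortened gaps respect the bound \<open>f\<close> for the
  lengthened segments.
\<close>

lemma nonuniform_specification_factor:
  fixes X :: "'a::metric_space set" and Y :: "'b::metric_space set"
  assumes ds: "dynamical_system X T" and fm: "factor_map X T Y S \<pi>"
    and window: "\<forall>x\<in>X. \<forall>y\<in>X. (\<forall>m\<le>2 * N. dist ((T ^^ m) x) ((T ^^ m) y) < \<delta>)
      \<longrightarrow> dist (\<pi> ((T ^^ N) x)) (\<pi> ((T ^^ N) y)) < \<eta>"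
    and spec: "nonuniform_specification X T f \<delta>"
  shows "nonuniform_specification Y S (\<lambda>n. f (n + 2 * N) + 2 * N) \<eta>"
  unfolding nonuniform_specification_def
proof (intro allI impI, elim conjE)
  note D = dynamical_system_inverse[OF ds]
  fix k ys and ns ms :: "nat list"
  assume k: "1 \<le> k" and ys: "length ys = k" "set ys \<subseteq> Y"
    and ns: "length ns = k" "\<forall>n\<in>set ns. n > 0" and ms: "length ms = k - 1"
    and gaps: "\<forall>i<k - 1. max (f (ns ! i + 2 * N) + 2 * N) (f (ns ! Suc i + 2 * N) + 2 * N) \<le> ms ! i"
  have im: "\<pi> ` X = Y" using fm by (simp add: factor_map_def)
  define xs where "xs = map (inv_into X \<pi>) ys"
  have xs: "length xs = k" "set xs \<subseteq> X" "map \<pi> xs = ys"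
    using ys im by (auto simp: xs_def subset_iff inv_into_into f_inv_into_f intro!: map_idI)
  define ms' where "ms' = map (\<lambda>m. m - 2 * N) ms"
  have ms': "map (\<lambda>m. m + 2 * N) ms' = ms"
    using gaps ms by (auto simp: ms'_def intro!: nth_equalityI)
  have "\<exists>z\<in>X. shadows T \<delta> z (map (inv_into X T ^^ N) xs) (map (\<lambda>n. n + 2 * N) ns) ms'"
  proof (rule spec[unfolded nonuniform_specification_def, rule_format, OF k], intro conjI)
    show "set (map (inv_into X T ^^ N) xs) \<subseteq> X"
      using xs(2) funpow_in_image[OF D(5)] by auto
    show "\<forall>i<k - 1. max (f (map (\<lambda>n. n + 2 * N) ns ! i)) (f (map (\<lambda>n. n + 2 * N) ns ! Suc i))
        \<le> ms' ! i"
      using gaps ns ms by (fastforce simp: ms'_def)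
  qed (use xs ns ms in \<open>auto simp: ms'_def\<close>)
  then obtain z where z: "z \<in> X"
    and "shadows T \<delta> z (map (inv_into X T ^^ N) xs) (map (\<lambda>n. n + 2 * N) ns) ms'"
    by blast
  then have "shadows S \<eta> (\<pi> ((T ^^ N) z)) (map \<pi> xs) ns (map (\<lambda>m. m + 2 * N) ms')"
    using xs ns ms by (intro shadows_factor[OF ds fm window]) (auto simp: ms'_def)
  then show "\<exists>z\<in>Y. shadows S \<eta> z ys ns ms"
    using xs ms' im funpow_in_image[OF D(4) z] by auto
qed

lemma nonuniform_transitivity_factor:
  fixes X :: "'a::metric_space set" and Y :: "'b::metric_space set"
  assumes ds: "dynamical_system X T" and fm: "factor_map X T Y S \<pi>"
    and window: "\<forall>x\<in>X. \<forall>y\<in>X. (\<forall>m\<le>2 * N. dist ((T ^^ m) x) ((T ^^ m) y) < \<delta>)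
      \<longrightarrow> dist (\<pi> ((T ^^ N) x)) (\<pi> ((T ^^ N) y)) < \<eta>"
    and trans: "nonuniform_transitivity X T f \<delta>"
  shows "nonuniform_transitivity Y S (\<lambda>n. f (n + 2 * N) + 2 * N) \<eta>"
  unfolding nonuniform_transitivity_def
proof (intro allI impI ballI)
  note D = dynamical_system_inverse[OF ds]
  fix n :: nat and y y'
  assume n: "1 \<le> n" and "y \<in> Y" "y' \<in> Y"
  have im: "\<pi> ` X = Y" using fm by (simp add: factor_map_def)
  obtain x x' where x: "x \<in> X" "x' \<in> X" "\<pi> x = y" "\<pi> x' = y'"
    using im \<open>y \<in> Y\<close> \<open>y' \<in> Y\<close> by blast
  have "(inv_into X T ^^ N) x \<in> X" "(inv_into X T ^^ N) x' \<in> X"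
    using x funpow_in_image[OF D(5)] by auto
  then obtain i z where "i \<le> f (n + 2 * N)" and z: "z \<in> X"
    and "shadows T \<delta> z [(inv_into X T ^^ N) x, (inv_into X T ^^ N) x']
      [n + 2 * N, n + 2 * N] [i]"
    using trans n unfolding nonuniform_transitivity_def by (meson trans_le_add1)
  then have "shadows S \<eta> (\<pi> ((T ^^ N) z)) [y, y'] [n, n] [i + 2 * N]"
    using shadows_factor[OF ds fm window, of "[x, x']" z "[n, n]" "[i]"] x by simp
  moreover have "\<pi> ((T ^^ N) z) \<in> Y"
    using im funpow_in_image[OF D(4) z] by auto
  ultimately show "\<exists>i\<le>f (n + 2 * N) + 2 * N. \<exists>z\<in>Y. shadows S \<eta> z [y, y'] [n, n] [i]"
    using \<open>i \<le> f (n + 2 * N)\<close> by (meson add_le_mono1)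
qed

section \<open>Sublogarithmic growth\<close>

text \<open>
  For nonnegative sequences, a characterization by the frequency of small values makes the
  limit inferior accessible to arguments along a sequence of good times.
\<close>

lemma liminf_ereal_eq_0_iff_frequently:
  fixes u :: "nat \<Rightarrow> real"
  assumes "\<And>n. u n \<ge> 0"
  shows "liminf (\<lambda>n. ereal (u n)) = 0 \<longleftrightarrow> (\<forall>e>0. \<exists>\<^sub>F n in sequentially. u n < e)"
proof -
  have "liminf (\<lambda>n. ereal (u n)) \<ge> 0"
    using assms by (intro Liminf_bounded) auto
  then have "liminf (\<lambda>n. ereal (u n)) = 0 \<longleftrightarrow> liminf (\<lambda>n. ereal (u n)) \<le> 0"
    by auto
  also have "\<dots> \<longleftrightarrow> (\<forall>e>0. \<exists>\<^sub>F n in sequentially. u n < e)"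
  proof
    assume L: "liminf (\<lambda>n. ereal (u n)) \<le> 0"
    show "\<forall>e>0. \<exists>\<^sub>F n in sequentially. u n < e"
    proof (intro allI impI, rule ccontr)
      fix e :: real assume "e > 0" and "\<not> (\<exists>\<^sub>F n in sequentially. u n < e)"
      then have "\<forall>\<^sub>F n in sequentially. ereal e \<le> ereal (u n)"
        by (simp add: not_frequently not_less)
      then have "ereal e \<le> liminf (\<lambda>n. ereal (u n))"
        by (rule Liminf_bounded)
      with L \<open>e > 0\<close> show False
        by (metis ereal_less_eq(3) not_le order_trans zero_ereal_def)
    qed
  next
    assume F: "\<forall>e>0. \<exists>\<^sub>F n in sequentially. u n < e"
    show "liminf (\<lambda>n. ereal (u n)) \<le> 0"
    proof (rule ccontr)
      assume "\<not> ?thesis"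
      then have "0 < liminf (\<lambda>n. ereal (u n))"
        by (simp add: not_le)
      then obtain e where "0 < ereal e" and e: "ereal e < liminf (\<lambda>n. ereal (u n))"
        using ereal_dense2 by blast
      then have "\<forall>\<^sub>F n in sequentially. ereal e < ereal (u n)"
        by (intro less_LiminfD)
      then have "\<forall>\<^sub>F n in sequentially. \<not> u n < e"
        by eventually_elim auto
      with F \<open>0 < ereal e\<close> show False
        by (auto simp: frequently_def)
    qed
  qed
  finally show ?thesis .
qed

text \<open>
  The shift cannot be removed from the limit inferior by a limit law, because the quotient need
  not converge. Instead, a time \<open>n + M\<close> at which the given quotient is small is used at \<open>n\<close>: for
  large \<open>n\<close> the denominator shrinks at most by the factor \<open>2\<close>, and the summand \<open>M\<close> is negligible.
\<close>

lemma liminf_div_ln_shift: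
  fixes f :: "nat \<Rightarrow> nat"
  assumes "liminf (\<lambda>n. ereal (real (f n) / ln (real n))) = 0"
  shows "liminf (\<lambda>n. ereal (real (f (n + M) + M) / ln (real n))) = 0"
proof -
  have nonneg: "0 \<le> real a / ln (real n)" for a n :: nat
    by (cases "n = 0") auto
  have freq: "\<forall>e>0. \<exists>\<^sub>F n in sequentially. real (f n) / ln (real n) < e"
    using assms liminf_ereal_eq_0_iff_frequently[of "\<lambda>n. real (f n) / ln (real n)"] nonneg by simp
  have "\<exists>\<^sub>F n in sequentially. real (f (n + M) + M) / ln (real n) < e" if "e > 0" for e
  proof -
    have "\<forall>\<^sub>F n in sequentially. ln (real (n + M)) \<le> 2 * ln (real n)"
      by real_asymp
    moreover have "\<forall>\<^sub>F n in sequentially. real M / ln (real n) < e / 2"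
      using \<open>e > 0\<close> by real_asymp
    moreover have "\<forall>\<^sub>F n in sequentially. ln (real n) > 0"
      by real_asymp
    moreover have "\<forall>\<^sub>F n in sequentially. ln (real (n + M)) > 0"
      by real_asymp
    ultimately have ev: "\<forall>\<^sub>F n in sequentially. real (f (n + M)) / ln (real (n + M)) < e / 4
        \<longrightarrow> real (f (n + M) + M) / ln (real n) < e"
    proof eventually_elim
      case (elim n)
      show ?case
      proof
        assume a: "real (f (n + M)) / ln (real (n + M)) < e / 4"
        then have "real (f (n + M)) < e / 4 * ln (real (n + M))"
          using elim(4) by (simp add: divide_less_eq)
        also have "\<dots> \<le> e / 4 * (2 * ln (real n))"
          using elim(1) \<open>e > 0\<close> by (intro mult_left_mono) auto
        finally have "real (f (n + M)) / ln (real n) < e / 2"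
          using elim(3) by (simp add: divide_less_eq)
        moreover have "real (f (n + M) + M) / ln (real n)
            = real (f (n + M)) / ln (real n) + real M / ln (real n)"
          by (simp add: add_divide_distrib)
        ultimately show "real (f (n + M) + M) / ln (real n) < e"
          using elim(2) by linarith
      qed
    qed
    have "\<exists>\<^sub>F n in sequentially. real (f n) / ln (real n) < e / 4"
      using freq[rule_format, of "e / 4"] \<open>e > 0\<close> by simp
    then have "\<exists>\<^sub>F n in sequentially. real (f (n + M)) / ln (real (n + M)) < e / 4"
      unfolding frequently_def
      using eventually_sequentially_seg[of "\<lambda>n. \<not> real (f n) / ln (real n) < e / 4" M] by simp
    then show ?thesis
      using ev by (rule frequently_rev_mp)
  qed
  then show ?thesis
    using liminf_ereal_eq_0_iff_frequently[of "\<lambda>n. real (f (n + M) + M) / ln (real n)", OF nonneg]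
    by blast
qed

lemma tendsto_div_ln_shift:
  fixes f :: "nat \<Rightarrow> nat"
  assumes "(\<lambda>n. real (f n) / ln (real n)) \<longlonglongrightarrow> 0"
  shows "(\<lambda>n. real (f (n + M) + M) / ln (real n)) \<longlonglongrightarrow> 0"
proof -
  have "(\<lambda>n. real (f (n + M)) / ln (real (n + M))) \<longlonglongrightarrow> 0"
    using LIMSEQ_ignore_initial_segment[OF assms] .
  moreover have "(\<lambda>n. ln (real (n + M)) / ln (real n)) \<longlonglongrightarrow> 1"
    by real_asymp
  moreover have "(\<lambda>n. real M / ln (real n)) \<longlonglongrightarrow> 0"
    by real_asymp
  ultimately have "(\<lambda>n. real (f (n + M)) / ln (real (n + M)) * (ln (real (n + M)) / ln (real n))
      + real M / ln (real n)) \<longlonglongrightarrow> 0 * 1 + 0"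
    by (intro tendsto_intros)
  moreover have "\<forall>\<^sub>F n in sequentially.
      real (f (n + M)) / ln (real (n + M)) * (ln (real (n + M)) / ln (real n)) + real M / ln (real n)
      = real (f (n + M) + M) / ln (real n)"
  proof -
    have "\<forall>\<^sub>F n in sequentially. ln (real (n + M)) > 0"
      by real_asymp
    then show ?thesis
      by eventually_elim (simp add: add_divide_distrib)
  qed
  ultimately show ?thesis
    by (simp add: tendsto_cong)
qed

lemma mono_shift:
  fixes f :: "nat \<Rightarrow> nat"
  assumes "mono f"
  shows "mono (\<lambda>n. f (n + M) + M)"
  using assms by (auto simp: mono_def)

section \<open>Passage to expansive factors\<close>

theorem corollary3p4:
  fixes X :: "'a::metric_space set" and T :: "'a \<Rightarrow> 'a"
    and Y :: "'b::metric_space set" and S :: "'b \<Rightarrow> 'b"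
    and \<pi> :: "'a \<Rightarrow> 'b" and \<delta> \<eta> :: real
  assumes "dynamical_system X T" and "dynamical_system Y S"
    and "factor_map X T Y S \<pi>"
    and "expansive X T \<delta>" and "expansive Y S \<eta>"
  shows "(\<forall>f :: nat \<Rightarrow> nat. mono f \<and> nonuniform_specification X T f \<delta> \<and>
              liminf (\<lambda>n. ereal (real (f n) / ln (real n))) = 0 \<longrightarrow>
            (\<exists>f' :: nat \<Rightarrow> nat. mono f' \<and>
              liminf (\<lambda>n. ereal (real (f' n) / ln (real n))) = 0 \<and>
              nonuniform_specification Y S f' \<eta>)) \<and>
         (\<forall>f :: nat \<Rightarrow> nat. mono f \<and> nonuniform_transitivity X T f \<delta> \<and>
              (\<lambda>n. real (f n) / ln (real n)) \<longlonglongrightarrow> 0 \<longrightarrow>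
            (\<exists>f' :: nat \<Rightarrow> nat. mono f' \<and>
              (\<lambda>n. real (f' n) / ln (real n)) \<longlonglongrightarrow> 0 \<and>
              nonuniform_transitivity Y S f' \<eta>))"
proof -
  have "\<eta> > 0"
    using assms(5) by (simp add: expansive_def)
  obtain N where "\<forall>x\<in>X. \<forall>y\<in>X. (\<forall>m\<le>2 * N. dist ((T ^^ m) x) ((T ^^ m) y) < \<delta>)
      \<longrightarrow> dist (\<pi> ((T ^^ N) x)) (\<pi> ((T ^^ N) y)) < \<eta>"
    using factor_map_window[OF assms(1,3,4) \<open>\<eta> > 0\<close>] by blast
  note transport = nonuniform_specification_factor[OF assms(1,3) this]
    nonuniform_transitivity_factor[OF assms(1,3) this]
  show ?thesis
  proof (intro conjI allI impI; elim conjE)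
    fix f :: "nat \<Rightarrow> nat"
    assume "mono f" "nonuniform_specification X T f \<delta>"
      "liminf (\<lambda>n. ereal (real (f n) / ln (real n))) = 0"
    then show "\<exists>f'. mono f' \<and> liminf (\<lambda>n. ereal (real (f' n) / ln (real n))) = 0 \<and>
        nonuniform_specification Y S f' \<eta>"
      by (intro exI[of _ "\<lambda>n. f (n + 2 * N) + 2 * N"] conjI mono_shift
          liminf_div_ln_shift transport(1))
  next
    fix f :: "nat \<Rightarrow> nat"
    assume "mono f" "nonuniform_transitivity X T f \<delta>"
      "(\<lambda>n. real (f n) / ln (real n)) \<longlonglongrightarrow> 0"
    then show "\<exists>f'. mono f' \<and> (\<lambda>n. real (f' n) / ln (real n)) \<longlonglongrightarrow> 0 \<and>
        nonuniform_transitivity Y S f' \<eta>"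
      by (intro exI[of _ "\<lambda>n. f (n + 2 * N) + 2 * N"] conjI mono_shift
          tendsto_div_ln_shift transport(2))
  qed
qed

end
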